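(* For integers $2\le n\le m$, $$\gamma^{LD}(K_n\times K_m)=\begin{cases} m-1, & 2n\le m \text{ and } (n,m)\ne(2,4),\\ \left\lceil \frac{2n+2m-1}{3}\right\rceil-1, & 2<n\le m<2n \text{ and } (n,m)\ne(4,4),\\ m, & n=2,\ m\le 4,\\ 5, & n=m=4.\end{cases}$$
   Context: $K_q$ is the complete graph on vertex set $\{1,\dots,q\}$. The direct product $G_1\times G_2$ has vertex set $V_1\times V_2$, with $(u_1,u_2)$ adjacent to $(v_1,v_2)$ iff $u_1v_1\in E_1$ and $u_2v_2\in E_2$. For a code (nonempty vertex subset) $C$ and vertex $v$, $I(C;v)=N[v]\cap C$, where $N[v]$ is the closed neighbourhood. A code $C$ is locating-dominating if for all distinct non-codewords $u,v$, $I(C;u)\ne\emptyset$ and $I(C;u)\ne I(C;v)$. $\gamma^{LD}(G)$ is the minimum size of a locating-dominating code in $G$. *)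

theory Defs
  imports Complex_Main
begin

text \<open>A (simple) graph is given by a vertex set V and a symmetric adjacency predicate E.\<close>

definition closed_nbhd :: "'a set \<Rightarrow> ('a \<Rightarrow> 'a \<Rightarrow> bool) \<Rightarrow> 'a \<Rightarrow> 'a set" where
  "closed_nbhd V E v = {u \<in> V. u = v \<or> E v u}"

definition I_set :: "'a set \<Rightarrow> ('a \<Rightarrow> 'a \<Rightarrow> bool) \<Rightarrow> 'a set \<Rightarrow> 'a \<Rightarrow> 'a set" where
  "I_set V E C v = closed_nbhd V E v \<inter> C"

definition locating_dominating :: "'a set \<Rightarrow> ('a \<Rightarrow> 'a \<Rightarrow> bool) \<Rightarrow> 'a set \<Rightarrow> bool" where
  "locating_dominating V E C \<longleftrightarrow> C \<subseteq> V \<and> C \<noteq> {} \<and>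
     (\<forall>u \<in> V - C. I_set V E C u \<noteq> {}) \<and>
     (\<forall>u \<in> V - C. \<forall>v \<in> V - C. u \<noteq> v \<longrightarrow> I_set V E C u \<noteq> I_set V E C v)"

definition gamma_LD :: "'a set \<Rightarrow> ('a \<Rightarrow> 'a \<Rightarrow> bool) \<Rightarrow> nat" where
  "gamma_LD V E = (LEAST k. \<exists>C. locating_dominating V E C \<and> card C = k)"

definition K_vert :: "nat \<Rightarrow> nat set" where "K_vert q = {1..q}"
definition K_adj :: "nat \<Rightarrow> nat \<Rightarrow> bool" where "K_adj u v \<longleftrightarrow> u \<noteq> v"

definition dprod_vert :: "'a set \<Rightarrow> 'b set \<Rightarrow> ('a \<times> 'b) set" where
  "dprod_vert V1 V2 = V1 \<times> V2"
definition dprod_adj :: "('a \<Rightarrow> 'a \<Rightarrow> bool) \<Rightarrow> ('b \<Rightarrow> 'b \<Rightarrow> bool) \<Rightarrow> 'a \<times> 'b \<Rightarrow> 'a \<times> 'b \<Rightarrow> bool" where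
  "dprod_adj E1 E2 x y \<longleftrightarrow> E1 (fst x) (fst y) \<and> E2 (snd x) (snd y)"

end

theory Submission
  imports Defs
begin

text \<open>
  Read a code as the edge set of a bipartite graph between rows and columns. Two non-codewords
  are confused exactly when the graph has two isolated rows, two isolated columns, two
  single-edge components, or a single-edge component together with an isolated row and an
  isolated column; and a non-codeword is undominated when its row and column cover all edges.
  Giving the edge \<open>(r, c)\<close> the weight \<open>1 / deg r + 1 / deg c\<close>, which is at most \<open>3 / 2\<close> outside
  single-edge components, the total weight is the number of non-isolated vertices, whence
  \<open>2 n + 2 m - 4 \<le> 3 |C|\<close>. Conversely, optimal graphs arise from four small ones by adding
  paths on three vertices and leaves.
\<close>

section \<open>Codes as sets of squares in a grid\<close>

abbreviation rook_code :: "nat \<Rightarrow> nat \<Rightarrow> (nat \<times> nat) set \<Rightarrow> bool" where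
  "rook_code n m C \<equiv>
    locating_dominating (dprod_vert (K_vert n) (K_vert m)) (dprod_adj K_adj K_adj) C"

text \<open>A non-codeword does not occur in its own \<open>I_set\<close>, so only adjacency
  remains: a codeword is seen exactly when it shares neither row nor column with \<open>u\<close>.
  The product is thus the complement of the rook's graph.\<close>

lemma I_set_direct_product:
  assumes "C \<subseteq> dprod_vert (K_vert n) (K_vert m)" "u \<notin> C"
  shows "I_set (dprod_vert (K_vert n) (K_vert m)) (dprod_adj K_adj K_adj) C u =
    {e \<in> C. fst e \<noteq> fst u \<and> snd e \<noteq> snd u}"
  using assms by (auto simp: I_set_def closed_nbhd_def dprod_adj_def K_adj_def)

lemma rook_code_iff:
  "rook_code n m C \<longleftrightarrow> C \<subseteq> {1..n} \<times> {1..m} \<and> C \<noteq> {} \<and>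
    (\<forall>u \<in> {1..n} \<times> {1..m} - C. \<exists>e\<in>C. fst e \<noteq> fst u \<and> snd e \<noteq> snd u) \<and>
    (\<forall>u \<in> {1..n} \<times> {1..m} - C. \<forall>v \<in> {1..n} \<times> {1..m} - C. u \<noteq> v \<longrightarrow>
      {e \<in> C. fst e \<noteq> fst u \<and> snd e \<noteq> snd u} \<noteq> {e \<in> C. fst e \<noteq> fst v \<and> snd e \<noteq> snd v})"
proof (cases "C \<subseteq> {1..n} \<times> {1..m}")
  case True
  then have I: "u \<notin> C \<Longrightarrow> I_set (dprod_vert (K_vert n) (K_vert m)) (dprod_adj K_adj K_adj) C u =
      {e \<in> C. fst e \<noteq> fst u \<and> snd e \<noteq> snd u}" for u
    by (intro I_set_direct_product) (auto simp: dprod_vert_def K_vert_def)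
  have V: "dprod_vert (K_vert n) (K_vert m) = {1..n} \<times> {1..m}"
    by (simp add: dprod_vert_def K_vert_def)
  have "u \<notin> C \<Longrightarrow> I_set ({1..n} \<times> {1..m}) (dprod_adj K_adj K_adj) C u \<noteq> {} \<longleftrightarrow>
      (\<exists>e\<in>C. fst e \<noteq> fst u \<and> snd e \<noteq> snd u)" for u
    using I[unfolded V, of u] by blast
  then have "(\<forall>u \<in> {1..n} \<times> {1..m} - C.
        I_set ({1..n} \<times> {1..m}) (dprod_adj K_adj K_adj) C u \<noteq> {}) \<longleftrightarrow>
      (\<forall>u \<in> {1..n} \<times> {1..m} - C. \<exists>e\<in>C. fst e \<noteq> fst u \<and> snd e \<noteq> snd u)"
    by (intro ball_cong refl) blast
  moreover have "(\<forall>u \<in> {1..n} \<times> {1..m} - C. \<forall>v \<in> {1..n} \<times> {1..m} - C. u \<noteq> v \<longrightarrow>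
        I_set ({1..n} \<times> {1..m}) (dprod_adj K_adj K_adj) C u \<noteq>
        I_set ({1..n} \<times> {1..m}) (dprod_adj K_adj K_adj) C v) \<longleftrightarrow>
      (\<forall>u \<in> {1..n} \<times> {1..m} - C. \<forall>v \<in> {1..n} \<times> {1..m} - C. u \<noteq> v \<longrightarrow>
        {e \<in> C. fst e \<noteq> fst u \<and> snd e \<noteq> snd u} \<noteq> {e \<in> C. fst e \<noteq> fst v \<and> snd e \<noteq> snd v})"
    using I[unfolded V] by (intro ball_cong refl) simp
  ultimately show ?thesis
    unfolding locating_dominating_def V by (simp only:)
next
  case False
  then show ?thesis
    by (simp add: locating_dominating_def dprod_vert_def K_vert_def)
qed

lemma gamma_LD_direct_productI:
  assumes "rook_code n m C" "card C = k" "\<And>D. rook_code n m D \<Longrightarrow> k \<le> card D"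
  shows "gamma_LD (dprod_vert (K_vert n) (K_vert m)) (dprod_adj K_adj K_adj) = k"
  unfolding gamma_LD_def using assms by (intro Least_equality) auto

section \<open>Lower bounds\<close>

text \<open>Each nonempty fibre of \<open>f\<close> on \<open>C\<close> contributes its size times
  the reciprocal of its size, hence 1.\<close>

lemma sum_inverse_fibre_card:
  assumes "finite C"
  shows "(\<Sum>e\<in>C. 1 / real (card {e' \<in> C. f e' = f e})) = real (card (f ` C))"
proof -
  have "(\<Sum>e\<in>C. 1 / real (card {e' \<in> C. f e' = f e})) =
      (\<Sum>y\<in>f ` C. \<Sum>e\<in>{e \<in> C. f e = y}. 1 / real (card {e' \<in> C. f e' = f e}))"
    by (rule sum.image_gen[OF assms])
  also have "\<dots> = (\<Sum>y\<in>f ` C. 1)"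
  proof (rule sum.cong)
    fix y assume "y \<in> f ` C"
    \<comment> \<open>The quotient cancels only for a nonempty fibre, since division by zero yields
      0.\<close>
    then have "card {e \<in> C. f e = y} \<noteq> 0"
      using assms by auto
    then show "(\<Sum>e\<in>{e \<in> C. f e = y}. 1 / real (card {e' \<in> C. f e' = f e})) = 1"
      by simp
  qed simp
  finally show ?thesis by simp
qed

text \<open>These are the single-edge components of the bipartite graph.\<close>

definition lone_edges :: "('a \<times> 'b) set \<Rightarrow> ('a \<times> 'b) set" where
  "lone_edges C = {e \<in> C. \<forall>e'\<in>C. fst e' = fst e \<or> snd e' = snd e \<longrightarrow> e' = e}"

definition edge_weight :: "('a \<times> 'b) set \<Rightarrow> 'a \<times> 'b \<Rightarrow> real" where
  "edge_weight C e = 1 / real (card {e' \<in> C. fst e' = fst e}) +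
    1 / real (card {e' \<in> C. snd e' = snd e})"

lemma sum_edge_weight:
  "finite C \<Longrightarrow> (\<Sum>e\<in>C. edge_weight C e) = real (card (fst ` C)) + real (card (snd ` C))"
  by (simp add: edge_weight_def sum.distrib sum_inverse_fibre_card)

text \<open>An edge that is not lone shares an end with another edge; that end has degree at least 2
  and contributes at most \<open>1 / 2\<close>, the other end at most 1.\<close>

lemma edge_weight_le:
  assumes "finite C" "e \<in> C"
  shows "edge_weight C e \<le> 3 / 2 + (if e \<in> lone_edges C then 1 / 2 else 0)"
proof -
  let ?R = "{e' \<in> C. fst e' = fst e}" and ?S = "{e' \<in> C. snd e' = snd e}"
  have pos: "1 \<le> card ?R" "1 \<le> card ?S"
    using assms card_mono[of ?R "{e}"] card_mono[of ?S "{e}"] by simp_all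
  have le1: "1 / real (card ?R) \<le> 1" "1 / real (card ?S) \<le> 1"
    using pos by auto
  have half: "1 / real k \<le> 1 / 2" if "2 \<le> k" for k
    using that by (simp add: field_simps)
  show ?thesis
  proof (cases "e \<in> lone_edges C")
    case True
    moreover have "edge_weight C e \<le> 2"
      using le1 unfolding edge_weight_def by linarith
    ultimately show ?thesis by simp
  next
    case False
    then obtain e' where "e' \<in> C" "e' \<noteq> e" "fst e' = fst e \<or> snd e' = snd e"
      using assms by (auto simp: lone_edges_def)
    then have "{e, e'} \<subseteq> ?R \<or> {e, e'} \<subseteq> ?S"
      using assms by auto
    then have "2 \<le> card ?R \<or> 2 \<le> card ?S"
      using card_mono[of ?R "{e, e'}"] card_mono[of ?S "{e, e'}"] assms \<open>e' \<noteq> e\<close> by auto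
    then have "1 / real (card ?R) \<le> 1 / 2 \<or> 1 / real (card ?S) \<le> 1 / 2"
      using half by blast
    then have "edge_weight C e \<le> 3 / 2"
      using le1 unfolding edge_weight_def by linarith
    then show ?thesis
      using False by simp
  qed
qed

section \<open>Structure and size of an arbitrary code\<close>

context
  fixes n m :: nat and C :: "(nat \<times> nat) set"
  assumes n2: "2 \<le> n" and m2: "2 \<le> m" and code: "rook_code n m C"
begin

lemma code_subset: "C \<subseteq> {1..n} \<times> {1..m}"
  using code by (simp add: rook_code_iff)

lemma code_finite: "finite C"
  using code_subset finite_subset by blast

lemma code_dominating:
  assumes "a \<in> {1..n}" "b \<in> {1..m}" "(a, b) \<notin> C"
  shows "\<exists>e\<in>C. fst e \<noteq> a \<and> snd e \<noteq> b"
proof -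
  have "\<forall>u \<in> {1..n} \<times> {1..m} - C. \<exists>e\<in>C. fst e \<noteq> fst u \<and> snd e \<noteq> snd u"
    using code unfolding rook_code_iff by (elim conjE)
  then have "\<exists>e\<in>C. fst e \<noteq> fst (a, b) \<and> snd e \<noteq> snd (a, b)"
    by (rule bspec) (use assms in simp)
  then show ?thesis
    by simp
qed

text \<open>Stated through the edges that a square meets instead of those it sees; equality of
  either set is equality of the other. Each use picks two squares that meet the same edges.\<close>

lemma code_locating:
  assumes "a \<in> {1..n}" "b \<in> {1..m}" "(a, b) \<notin> C" "a' \<in> {1..n}" "b' \<in> {1..m}" "(a', b') \<notin> C"
    and "\<And>e. e \<in> C \<Longrightarrow> fst e = a \<or> snd e = b \<longleftrightarrow> fst e = a' \<or> snd e = b'"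
  shows "(a, b) = (a', b')"
proof (rule ccontr)
  assume ne: "(a, b) \<noteq> (a', b')"
  have loc: "\<forall>u \<in> {1..n} \<times> {1..m} - C. \<forall>v \<in> {1..n} \<times> {1..m} - C. u \<noteq> v \<longrightarrow>
      {e \<in> C. fst e \<noteq> fst u \<and> snd e \<noteq> snd u} \<noteq> {e \<in> C. fst e \<noteq> fst v \<and> snd e \<noteq> snd v}"
    using code unfolding rook_code_iff by (elim conjE)
  have "{e \<in> C. fst e \<noteq> a \<and> snd e \<noteq> b} = {e \<in> C. fst e \<noteq> a' \<and> snd e \<noteq> b'}"
    using assms(7) by blast
  moreover have "{e \<in> C. fst e \<noteq> a \<and> snd e \<noteq> b} \<noteq> {e \<in> C. fst e \<noteq> a' \<and> snd e \<noteq> b'}"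
    using bspec[OF bspec[OF loc, of "(a, b)"], of "(a', b')"] ne assms(1-6) by simp
  ultimately show False by blast
qed

text \<open>In an isolated row the square of column 1 meets just the edges of that column, whichever
  isolated row is taken.\<close>

lemma isolated_row_unique:
  assumes "a \<in> {1..n} - fst ` C" "a' \<in> {1..n} - fst ` C"
  shows "a = a'"
proof -
  have avoid: "\<And>e. e \<in> C \<Longrightarrow> fst e \<noteq> a \<and> fst e \<noteq> a'"
    using assms by blast
  have "(a, 1) = (a', 1::nat)"
  proof (rule code_locating)
    show "(a, 1) \<notin> C" "(a', 1) \<notin> C"
      using avoid[of "(a, 1)"] avoid[of "(a', 1)"] by auto
    show "fst e = a \<or> snd e = 1 \<longleftrightarrow> fst e = a' \<or> snd e = 1" if "e \<in> C" for e
      using avoid[OF that] by simp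
  qed (use assms m2 in simp_all)
  then show ?thesis by simp
qed

lemma isolated_col_unique:
  assumes "b \<in> {1..m} - snd ` C" "b' \<in> {1..m} - snd ` C"
  shows "b = b'"
proof -
  have avoid: "\<And>e. e \<in> C \<Longrightarrow> snd e \<noteq> b \<and> snd e \<noteq> b'"
    using assms by blast
  have "(1::nat, b) = (1, b')"
  proof (rule code_locating)
    show "(1, b) \<notin> C" "(1, b') \<notin> C"
      using avoid[of "(1, b)"] avoid[of "(1, b')"] by auto
    show "fst e = 1 \<or> snd e = b \<longleftrightarrow> fst e = 1 \<or> snd e = b'" if "e \<in> C" for e
      using avoid[OF that] by simp
  qed (use assms n2 in simp_all)
  then show ?thesis by simp
qed

text \<open>For lone edges \<open>(r, c)\<close> and \<open>(r', c')\<close> the crossed squares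
  \<open>(r, c')\<close> and \<open>(r', c)\<close> are non-codewords that both meet exactly these
  two edges.\<close>

lemma lone_edge_unique:
  assumes "e \<in> lone_edges C" "e' \<in> lone_edges C"
  shows "e = e'"
proof (rule ccontr)
  assume ne: "e \<noteq> e'"
  obtain r c r' c' where e: "e = (r, c)" "e' = (r', c')" by fastforce
  have mem: "(r, c) \<in> C" "(r', c') \<in> C" and
    lone: "\<And>x. x \<in> C \<Longrightarrow> fst x = r \<or> snd x = c \<Longrightarrow> x = (r, c)"
      "\<And>x. x \<in> C \<Longrightarrow> fst x = r' \<or> snd x = c' \<Longrightarrow> x = (r', c')"
    using assms[unfolded lone_edges_def e mem_Collect_eq fst_conv snd_conv] by blast+
  have "r \<noteq> r'" "c \<noteq> c'"
    using lone(1)[OF mem(2)] ne e by auto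
  have "(r, c') = (r', c)"
  proof (rule code_locating)
    show "(r, c') \<notin> C" "(r', c) \<notin> C"
      using lone(1)[of "(r, c')"] lone(1)[of "(r', c)"] \<open>r \<noteq> r'\<close> \<open>c \<noteq> c'\<close> by auto
    show "fst x = r \<or> snd x = c' \<longleftrightarrow> fst x = r' \<or> snd x = c" if "x \<in> C" for x
      using lone[OF that] by (metis fst_conv snd_conv)
  qed (use mem code_subset in blast)+
  then show False using \<open>r \<noteq> r'\<close> by simp
qed

text \<open>The squares \<open>(r, b)\<close> and \<open>(a, c)\<close> would both meet only the
  lone edge \<open>(r, c)\<close>.\<close>

lemma lone_edge_isolated:
  assumes "e \<in> lone_edges C" "a \<in> {1..n} - fst ` C" "b \<in> {1..m} - snd ` C"
  shows False
proof -
  obtain r c where e: "e = (r, c)" by fastforce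
  have mem: "(r, c) \<in> C" and
    lone: "\<And>x. x \<in> C \<Longrightarrow> fst x = r \<or> snd x = c \<Longrightarrow> x = (r, c)"
    using assms(1)[unfolded lone_edges_def e mem_Collect_eq fst_conv snd_conv] by blast+
  have ab: "\<And>x. x \<in> C \<Longrightarrow> fst x \<noteq> a \<and> snd x \<noteq> b"
    using assms by blast
  have ab_range: "a \<in> {1..n}" "b \<in> {1..m}"
    using assms by simp_all
  have "(r, b) = (a, c)"
  proof (rule code_locating)
    show "(r, b) \<notin> C" "(a, c) \<notin> C"
      using ab[of "(r, b)"] ab[of "(a, c)"] by auto
    show "fst x = r \<or> snd x = b \<longleftrightarrow> fst x = a \<or> snd x = c" if "x \<in> C" for x
      using lone[OF that] ab[OF that] by (metis fst_conv snd_conv)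
  qed (use mem code_subset ab_range in blast)+
  then show False using ab[OF mem] by simp
qed

lemma nonisolated_counts:
  "card (fst ` C) + card ({1..n} - fst ` C) = n"
  "card (snd ` C) + card ({1..m} - snd ` C) = m"
proof -
  have "fst ` C \<subseteq> {1..n}" "snd ` C \<subseteq> {1..m}"
    using code_subset by auto
  then show "card (fst ` C) + card ({1..n} - fst ` C) = n"
    "card (snd ` C) + card ({1..m} - snd ` C) = m"
    using card_mono[of "{1..n}" "fst ` C"] card_mono[of "{1..m}" "snd ` C"]
    by (simp_all add: card_Diff_subset code_finite)
qed

text \<open>Each of the three defects occurs at most once, and not all three occur together; this
  gives the joint bound 2.\<close>

lemma isolated_counts:
  "card ({1..n} - fst ` C) \<le> 1" "card ({1..m} - snd ` C) \<le> 1" "card (lone_edges C) \<le> 1"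
  "card ({1..n} - fst ` C) + card ({1..m} - snd ` C) + card (lone_edges C) \<le> 2"
proof -
  have fin: "finite ({1..n} - fst ` C)" "finite ({1..m} - snd ` C)" "finite (lone_edges C)"
    using code_finite by (simp_all add: lone_edges_def)
  show 1: "card ({1..n} - fst ` C) \<le> 1" "card ({1..m} - snd ` C) \<le> 1" "card (lone_edges C) \<le> 1"
    using isolated_row_unique isolated_col_unique lone_edge_unique
    by (metis One_nat_def fin card_le_Suc0_iff_eq)+
  have "{1..n} - fst ` C = {} \<or> {1..m} - snd ` C = {} \<or> lone_edges C = {}"
    using lone_edge_isolated by blast
  then have "card ({1..n} - fst ` C) = 0 \<or> card ({1..m} - snd ` C) = 0 \<or> card (lone_edges C) = 0"
    by (metis card.empty)
  then show "card ({1..n} - fst ` C) + card ({1..m} - snd ` C) + card (lone_edges C) \<le> 2"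
    using 1 by linarith
qed

text \<open>All columns but at most one need an edge, and an edge serves only one column.\<close>

lemma code_card_ge_columns: "m - 1 \<le> card C"
  using nonisolated_counts(2) isolated_counts(2) card_image_le[OF code_finite, of snd] by linarith

lemma sum_edge_weight_le:
  "(\<Sum>e\<in>C. edge_weight C e) \<le> 3 / 2 * real (card C) + 1 / 2 * real (card (lone_edges C))"
proof -
  have "(\<Sum>e\<in>C. edge_weight C e) \<le> (\<Sum>e\<in>C. 3 / 2 + (if e \<in> lone_edges C then 1 / 2 else 0))"
    using edge_weight_le[OF code_finite] by (intro sum_mono)
  also have "\<dots> = 3 / 2 * real (card C) + 1 / 2 * real (card (C \<inter> lone_edges C))"
    by (simp add: sum.distrib sum.If_cases code_finite Int_def)
  also have "C \<inter> lone_edges C = lone_edges C"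
    by (auto simp: lone_edges_def)
  finally show ?thesis .
qed

text \<open>The total weight is \<open>n + m\<close> minus one for each isolated row or column, and
  at most \<open>3 / 2\<close> per edge plus \<open>1 / 2\<close> for a lone edge. By
  \<open>isolated_counts\<close> these corrections add up to at most 2.\<close>

lemma code_card_ge_weight: "2 * n + 2 * m \<le> 3 * card C + 4"
proof -
  have "real n + real m \<le> 3 / 2 * real (card C) + 2"
    using sum_edge_weight_le sum_edge_weight[OF code_finite] nonisolated_counts isolated_counts
    by linarith
  then show ?thesis by linarith
qed

text \<open>With \<open>m - 1 \<le> 3\<close> edges one of the two rows holds at most one edge. The
  other row, together with a suitable column, then meets every edge, and their common square is an
  undominated non-codeword.\<close>

lemma code_card_two_rows:
  assumes "n = 2" "m \<le> 4"
  shows "m \<le> card C"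
proof (rule ccontr)
  assume "\<not> m \<le> card C"
  then have k: "card C = m - 1" "card C \<le> 3"
    using code_card_ge_columns \<open>m \<le> 4\<close> by auto
  have im: "card (snd ` C) = card C" "card ({1..m} - snd ` C) = 1"
    using k nonisolated_counts(2) isolated_counts(2) card_image_le[OF code_finite, of snd] m2
    by linarith+
  \<comment> \<open>There are as many edges as non-isolated columns, so no column holds two.\<close>
  have inj: "inj_on snd C"
    using im(1) code_finite by (simp add: eq_card_imp_inj_on)
  obtain b0 where b0: "b0 \<in> {1..m} - snd ` C"
    using im(2) by (metis card.empty equals0I zero_neq_one)
  have rows: "fst e = 1 \<or> fst e = 2" if "e \<in> C" for e
    using code_subset that \<open>n = 2\<close> by force
  have "card C = card ({e \<in> C. fst e = 1} \<union> {e \<in> C. fst e = 2})"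
    using rows by (intro arg_cong[where f = card]) blast
  also have "\<dots> = card {e \<in> C. fst e = 1} + card {e \<in> C. fst e = 2}"
    using code_finite by (intro card_Un_disjoint) auto
  finally have "card {e \<in> C. fst e = 1} \<le> 1 \<or> card {e \<in> C. fst e = 2} \<le> 1"
    using k by linarith
  then obtain a a' where a: "card {e \<in> C. fst e = a} \<le> 1" "a \<in> {1,2}" "a' \<in> {1,2}" "a \<noteq> a'"
    using that[of 1 2] that[of 2 1] by auto
  have covered: "fst e = a' \<or> e \<in> {e \<in> C. fst e = a}" if "e \<in> C" for e
    using rows[OF that] that a(2-4) by auto
  \<comment> \<open>If row \<open>a\<close> is empty, \<open>b\<close> is the isolated column
    \<open>b0\<close>; otherwise it is the column of the only edge \<open>x\<close> in row
    \<open>a\<close>, which by injectivity has no edge in row \<open>a'\<close>.\<close>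
  obtain b where "b \<in> {1..m}" "(a', b) \<notin> C" "\<And>e. e \<in> C \<Longrightarrow> fst e = a' \<or> snd e = b"
  proof (cases "{e \<in> C. fst e = a} = {}")
    case True
    moreover have "(a', b0) \<notin> C"
      using b0 by (metis DiffD2 image_eqI snd_conv)
    ultimately show thesis
      using that[of b0] b0 covered by blast
  next
    case False
    then have "card {e \<in> C. fst e = a} = 1"
      using a(1) code_finite by (simp add: le_antisym Suc_le_eq card_gt_0_iff)
    then obtain x where x: "{e \<in> C. fst e = a} = {x}"
      by (meson card_1_singletonE)
    then have "x \<in> C" "fst x = a" by auto
    then have "(a', snd x) \<notin> C"
      using inj_onD[OF inj, of x "(a', snd x)"] a(4) by (metis fst_conv snd_conv)
    moreover have "x \<in> {1..n} \<times> {1..m}"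
      using \<open>x \<in> C\<close> code_subset by blast
    then have "snd x \<in> {1..m}"
      by (simp add: mem_Times_iff)
    moreover have "fst e = a' \<or> snd e = snd x" if "e \<in> C" for e
      using covered[OF that] unfolding x by blast
    ultimately show thesis
      using that[of "snd x"] by blast
  qed
  moreover have "a' \<in> {1..n}" using a(3) \<open>n = 2\<close> by auto
  ultimately show False
    using code_dominating by blast
qed

text \<open>
  With four edges the weight bound is tight, so every edge has weight exactly \<open>3 / 2\<close>; a row and a
  column of degree two are then non-adjacent and cover the four edges.
\<close>

lemma code_card_four_four:
  assumes "n = 4" "m = 4"
  shows "5 \<le> card C"
proof (rule ccontr)
  assume "\<not> 5 \<le> card C"
  then have k: "card C = 4"
    using code_card_ge_weight assms by linarith
  have tight: "real (card (fst ` C)) + real (card (snd ` C)) \<le> 6 + 1 / 2 * real (card (lone_edges C))"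
    using sum_edge_weight_le sum_edge_weight[OF code_finite] k by simp
  \<comment> \<open>A lone edge would force both an isolated row and an isolated column, against the
    joint bound. Without one, both are still forced, and the total weight is exactly 6.\<close>
  have cnt: "card (lone_edges C) = 0" "card (fst ` C) = 3" "card (snd ` C) = 3"
    using tight nonisolated_counts isolated_counts assms by linarith+
  have "lone_edges C = {}"
    using cnt(1) code_finite by (simp add: lone_edges_def)
  then have le: "edge_weight C e \<le> 3 / 2" if "e \<in> C" for e
    using edge_weight_le[OF code_finite that] by simp
  have "(\<Sum>e\<in>C. edge_weight C e) = (\<Sum>e\<in>C. 3 / 2)"
    using sum_edge_weight[OF code_finite] cnt k by simp
  then have eq: "edge_weight C e = 3 / 2" if "e \<in> C" for e
    using sum_mono_inv[of "edge_weight C" C "\<lambda>_. 3 / 2" e] le that code_finite by blast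
  \<comment> \<open>Four edges lie in three rows and in three columns, so some row and some column
    have degree at least 2.\<close>
  have "\<not> inj_on fst C" "\<not> inj_on snd C"
    using card_image[of fst C] card_image[of snd C] cnt k by auto
  then obtain x x' y y' where x: "x \<in> C" "x' \<in> C" "x \<noteq> x'" "fst x' = fst x"
    and y: "y \<in> C" "y' \<in> C" "y \<noteq> y'" "snd y' = snd y"
    unfolding inj_on_def by metis
  let ?R = "{e \<in> C. fst e = fst x}" and ?S = "{e \<in> C. snd e = snd y}"
  have "card {x, x'} \<le> card ?R"
    by (rule card_mono; use code_finite x in simp)
  moreover have "card {y, y'} \<le> card ?S"
    by (rule card_mono; use code_finite y in simp)
  ultimately have deg: "2 \<le> card ?R" "2 \<le> card ?S"
    using x(3) y(3) by simp_all
  have nonadj: "(fst x, snd y) \<notin> C"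
  proof
    assume "(fst x, snd y) \<in> C"
    then have "1 / real (card ?R) + 1 / real (card ?S) = 3 / 2"
      using eq[of "(fst x, snd y)"] by (simp add: edge_weight_def)
    moreover have "1 / real (card ?R) \<le> 1 / 2" "1 / real (card ?S) \<le> 1 / 2"
      using deg by (simp_all add: field_simps)
    ultimately show False by linarith
  qed
  then have "\<forall>e\<in>C. \<not> (fst e = fst x \<and> snd e = snd y)"
    by (metis prod.collapse)
  then have "?R \<inter> ?S = {}"
    by blast
  then have "4 \<le> card (?R \<union> ?S)"
    using deg code_finite by (simp add: card_Un_disjoint)
  moreover have "?R \<union> ?S \<subseteq> C"
    by blast
  ultimately have "?R \<union> ?S = C"
    by (intro card_seteq[OF code_finite]) (simp_all add: k)
  moreover have "x \<in> {1..n} \<times> {1..m}" "y \<in> {1..n} \<times> {1..m}"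
    using x(1) y(1) code_subset by blast+
  then have "fst x \<in> {1..n}" "snd y \<in> {1..m}"
    by (simp_all add: mem_Times_iff)
  ultimately show False
    using code_dominating[OF _ _ nonadj] by blast
qed

end

section \<open>Constructions\<close>

text \<open>
  Domination is demanded for all \<open>a\<close> and \<open>b\<close>, also outside the grid, so that it is inherited when
  rows and columns are added.
\<close>

definition extendable_code :: "nat \<Rightarrow> nat \<Rightarrow> (nat \<times> nat) set \<Rightarrow> bool" where
  "extendable_code n m C \<longleftrightarrow> C \<subseteq> {1..n} \<times> {1..m} \<and> C \<noteq> {} \<and>
    lone_edges C = {} \<and>
    (\<forall>a \<in> {1..n} - fst ` C. \<forall>a' \<in> {1..n} - fst ` C. a = a') \<and>
    (\<forall>b \<in> {1..m} - snd ` C. \<forall>b' \<in> {1..m} - snd ` C. b = b') \<and>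
    (\<forall>a b. (a, b) \<notin> C \<longrightarrow> (\<exists>e\<in>C. fst e \<noteq> a \<and> snd e \<noteq> b))"

lemma extendable_codeD:
  assumes "extendable_code n m C"
  shows "C \<subseteq> {1..n} \<times> {1..m}" "C \<noteq> {}" "lone_edges C = {}"
    "\<forall>a \<in> {1..n} - fst ` C. \<forall>a' \<in> {1..n} - fst ` C. a = a'"
    "\<forall>b \<in> {1..m} - snd ` C. \<forall>b' \<in> {1..m} - snd ` C. b = b'"
    "\<forall>a b. (a, b) \<notin> C \<longrightarrow> (\<exists>e\<in>C. fst e \<noteq> a \<and> snd e \<noteq> b)"
  using assms unfolding extendable_code_def by - (elim conjE; assumption)+

text \<open>Two distinct non-codewords meeting the same edges force two isolated columns if they
  share a row, and two isolated rows if they share a column. In general position they also force two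
  isolated rows, since lone edges are excluded.\<close>

lemma extendable_code_imp_rook_code:
  assumes ext: "extendable_code n m C"
  shows "rook_code n m C"
proof -
  have no_lone: "\<exists>e'\<in>C. e' \<noteq> e \<and> (fst e' = fst e \<or> snd e' = snd e)" if "e \<in> C" for e
    using extendable_codeD(3)[OF ext] that unfolding lone_edges_def by blast
  have False
    if a: "a \<in> {1..n}" "b \<in> {1..m}" "(a, b) \<notin> C" "a' \<in> {1..n}" "b' \<in> {1..m}" "(a', b') \<notin> C"
      and ne: "(a, b) \<noteq> (a', b')"
      and cov: "\<And>e. e \<in> C \<Longrightarrow> fst e = a \<or> snd e = b \<longleftrightarrow> fst e = a' \<or> snd e = b'"
    for a b a' b'
  proof -
    consider "a = a'" "b \<noteq> b'" | "a \<noteq> a'" "b = b'" | "a \<noteq> a'" "b \<noteq> b'"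
      using ne by auto
    then show False
    proof cases
      case 1
      then have "snd e \<noteq> b" "snd e \<noteq> b'" if "e \<in> C" for e
        using cov[OF that] that a by (metis prod.collapse)+
      then have "b \<notin> snd ` C" "b' \<notin> snd ` C"
        by blast+
      then show False
        using extendable_codeD(5)[OF ext] 1 a by blast
    next
      case 2
      then have "fst e \<noteq> a" "fst e \<noteq> a'" if "e \<in> C" for e
        using cov[OF that] that a by (metis prod.collapse)+
      then have "a \<notin> fst ` C" "a' \<notin> fst ` C"
        by blast+
      then show False
        using extendable_codeD(4)[OF ext] 2 a by blast
    next
      case 3
      \<comment> \<open>An edge in row \<open>a\<close> or column \<open>b'\<close> must meet both
        squares, which leaves only \<open>(a, b')\<close>; if present it would be lone. The same
        holds for \<open>(a', b)\<close>, so rows \<open>a\<close> and \<open>a'\<close> are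
        empty.\<close>
      have "e = (a, b')" if "e \<in> C" "fst e = a \<or> snd e = b'" for e
        using cov[OF that(1)] that a 3 by (metis prod.collapse)
      then have 1: "(a, b') \<notin> C"
        using no_lone[of "(a, b')"] by (metis fst_conv snd_conv)
      have "e = (a', b)" if "e \<in> C" "fst e = a' \<or> snd e = b" for e
        using cov[OF that(1)] that a 3 by (metis prod.collapse)
      then have 2: "(a', b) \<notin> C"
        using no_lone[of "(a', b)"] by (metis fst_conv snd_conv)
      have "fst e \<noteq> a" "fst e \<noteq> a'" if "e \<in> C" for e
        using cov[OF that] that 1 2 3 by (metis prod.collapse)+
      then have "a \<notin> fst ` C" "a' \<notin> fst ` C"
        by blast+
      then show False
        using extendable_codeD(4)[OF ext] 3 a by blast
    qed
  qed
  note locating = this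
  have "{e \<in> C. fst e \<noteq> fst u \<and> snd e \<noteq> snd u} \<noteq> {e \<in> C. fst e \<noteq> fst v \<and> snd e \<noteq> snd v}"
    if uv: "u \<in> {1..n} \<times> {1..m} - C" "v \<in> {1..n} \<times> {1..m} - C" "u \<noteq> v" for u v
  proof
    assume "{e \<in> C. fst e \<noteq> fst u \<and> snd e \<noteq> snd u} = {e \<in> C. fst e \<noteq> fst v \<and> snd e \<noteq> snd v}"
    then have "fst e = fst u \<or> snd e = snd u \<longleftrightarrow> fst e = fst v \<or> snd e = snd v" if "e \<in> C" for e
      using that by blast
    then show False
      using uv by (intro locating[of "fst u" "snd u" "fst v" "snd v"])
        (auto simp: mem_Times_iff prod_eq_iff)
  qed
  moreover have "\<forall>u \<in> {1..n} \<times> {1..m} - C. \<exists>e\<in>C. fst e \<noteq> fst u \<and> snd e \<noteq> snd u"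
    using extendable_codeD(6)[OF ext] by (metis DiffE prod.collapse)
  ultimately show ?thesis
    unfolding rook_code_iff using extendable_codeD(1,2)[OF ext] by blast
qed

text \<open>All new rows and columns are hit by \<open>D\<close>, so isolated ones can only be old.
  Old edges keep their companions and their role as witnesses of domination.\<close>

lemma extendable_code_Un:
  assumes ext: "extendable_code n m C"
    and D: "D \<subseteq> {1..n'} \<times> {1..m'}" "n \<le> n'" "m \<le> m'" "{n<..n'} \<subseteq> fst ` D" "{m<..m'} \<subseteq> snd ` D"
    and lone: "\<And>e. e \<in> D \<Longrightarrow> \<exists>e'\<in>C \<union> D. e' \<noteq> e \<and> (fst e' = fst e \<or> snd e' = snd e)"
  shows "extendable_code n' m' (C \<union> D)"
proof -
  have "{1..n'} \<subseteq> {1..n} \<union> {n<..n'}" "{1..m'} \<subseteq> {1..m} \<union> {m<..m'}"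
    by auto
  then have isolated: "{1..n'} - fst ` (C \<union> D) \<subseteq> {1..n} - fst ` C"
    "{1..m'} - snd ` (C \<union> D) \<subseteq> {1..m} - snd ` C"
    using D(4,5) by blast+
  have "{1..n} \<times> {1..m} \<subseteq> {1..n'} \<times> {1..m'}"
    using D(2,3) by (intro Sigma_mono) auto
  then have "C \<union> D \<subseteq> {1..n'} \<times> {1..m'}"
    using extendable_codeD(1)[OF ext] D(1) by blast
  moreover have "C \<union> D \<noteq> {}"
    using extendable_codeD(2)[OF ext] by blast
  moreover have "lone_edges (C \<union> D) = {}"
    using extendable_codeD(3)[OF ext] lone unfolding lone_edges_def by blast
  moreover have
    "\<forall>a \<in> {1..n'} - fst ` (C \<union> D). \<forall>a' \<in> {1..n'} - fst ` (C \<union> D). a = a'"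
    by (intro ballI extendable_codeD(4)[OF ext, rule_format] subsetD[OF isolated(1)])
  moreover have
    "\<forall>b \<in> {1..m'} - snd ` (C \<union> D). \<forall>b' \<in> {1..m'} - snd ` (C \<union> D). b = b'"
    by (intro ballI extendable_codeD(5)[OF ext, rule_format] subsetD[OF isolated(2)])
  moreover have "\<forall>a b. (a, b) \<notin> C \<union> D \<longrightarrow> (\<exists>e\<in>C \<union> D. fst e \<noteq> a \<and> snd e \<noteq> b)"
    using extendable_codeD(6)[OF ext] by blast
  ultimately show ?thesis
    unfolding extendable_code_def by - (intro conjI; assumption)
qed

section \<open>Growing codes by stars and leaves\<close>

definition extendable :: "nat \<Rightarrow> nat \<Rightarrow> nat \<Rightarrow> bool" where
  "extendable n m k \<longleftrightarrow> (\<exists>C. extendable_code n m C \<and> card C = k)"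

text \<open>Edges off the old grid are new, so the sizes add. The four extensions below are
  instances.\<close>

lemma extendable_add_edges:
  assumes "extendable_code n m C"
    and "D \<subseteq> {1..n'} \<times> {1..m'}" "n \<le> n'" "m \<le> m'" "{n<..n'} \<subseteq> fst ` D" "{m<..m'} \<subseteq> snd ` D"
    and "\<And>e. e \<in> D \<Longrightarrow> \<exists>e'\<in>C \<union> D. e' \<noteq> e \<and> (fst e' = fst e \<or> snd e' = snd e)"
    and "D \<inter> {1..n} \<times> {1..m} = {}" "k = card C + card D"
  shows "extendable n' m' k"
proof -
  have C: "C \<subseteq> {1..n} \<times> {1..m}"
    by (rule extendable_codeD(1)[OF assms(1)])
  then have "C \<inter> D = {}"
    using assms(8) by blast
  moreover have "finite C" "finite D"
    using finite_subset[OF C] finite_subset[OF assms(2)] by simp_all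
  ultimately have "card (C \<union> D) = k"
    using assms(9) by (simp add: card_Un_disjoint)
  moreover have "extendable_code n' m' (C \<union> D)"
    by (rule extendable_code_Un[OF assms(1-7)])
  ultimately show ?thesis
    unfolding extendable_def by blast
qed

text \<open>A path on three vertices centred at the new row: two edges of weight
  \<open>3 / 2\<close> each, the best rate that the weight bound allows.\<close>

lemma extendable_row_star:
  assumes "extendable n m k"
  shows "extendable (n + 1) (m + 2) (k + 2)"
proof -
  obtain C where C: "extendable_code n m C" "card C = k"
    using assms by (auto simp: extendable_def)
  show ?thesis
    by (rule extendable_add_edges[OF C(1), of "{(n + 1, m + 1), (n + 1, m + 2)}"])
      (use C(2) in auto)
qed

lemma extendable_col_star:
  assumes "extendable n m k"
  shows "extendable (n + 2) (m + 1) (k + 2)"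
proof -
  obtain C where C: "extendable_code n m C" "card C = k"
    using assms by (auto simp: extendable_def)
  show ?thesis
    by (rule extendable_add_edges[OF C(1), of "{(n + 1, m + 1), (n + 2, m + 1)}"])
      (use C(2) in auto)
qed

text \<open>The new edge is hung on a row that already has an edge, so it is not lone. One edge per
  column is the rate of \<open>code_card_ge_columns\<close>.\<close>

lemma extendable_col_leaf:
  assumes "extendable n m k"
  shows "extendable n (m + 1) (k + 1)"
proof -
  obtain C where C: "extendable_code n m C" "card C = k"
    using assms by (auto simp: extendable_def)
  then obtain r c where rc: "(r, c) \<in> C" "C \<subseteq> {1..n} \<times> {1..m}"
    unfolding extendable_code_def by fast
  then have range: "1 \<le> r" "r \<le> n" "1 \<le> c" "c \<le> m"
    by auto
  have "\<exists>e'\<in>C \<union> {(r, m + 1)}. e' \<noteq> (r, m + 1) \<and> (fst e' = fst (r, m + 1) \<or> snd e' = snd (r, m + 1))"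
    using rc(1) range by (intro bexI[of _ "(r, c)"]) auto
  then show ?thesis
    by (intro extendable_add_edges[OF C(1), of "{(r, m + 1)}"]) (use C(2) range in auto)
qed

lemma extendable_row_leaf:
  assumes "extendable n m k"
  shows "extendable (n + 1) m (k + 1)"
proof -
  obtain C where C: "extendable_code n m C" "card C = k"
    using assms by (auto simp: extendable_def)
  then obtain r c where rc: "(r, c) \<in> C" "C \<subseteq> {1..n} \<times> {1..m}"
    unfolding extendable_code_def by fast
  then have range: "1 \<le> r" "r \<le> n" "1 \<le> c" "c \<le> m"
    by auto
  have "\<exists>e'\<in>C \<union> {(n + 1, c)}. e' \<noteq> (n + 1, c) \<and> (fst e' = fst (n + 1, c) \<or> snd e' = snd (n + 1, c))"
    using rc(1) range by (intro bexI[of _ "(r, c)"]) auto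
  then show ?thesis
    by (intro extendable_add_edges[OF C(1), of "{(n + 1, c)}"]) (use C(2) range in auto)
qed

lemma extendable_col_leaves:
  "extendable n m k \<Longrightarrow> extendable n (m + j) (k + j)"
proof (induction j)
  case (Suc j)
  then show ?case using extendable_col_leaf[of n "m + j" "k + j"] by simp
qed simp

lemma extendable_stars:
  assumes "extendable n m k"
  shows "extendable (n + x + 2 * y) (m + 2 * x + y) (k + 2 * x + 2 * y)"
proof -
  have row: "extendable (n + x) (m + 2 * x) (k + 2 * x)"
  proof (induction x)
    case (Suc x)
    then show ?case using extendable_row_star[OF Suc] by (simp add: algebra_simps)
  qed (simp add: assms)
  show ?thesis
  proof (induction y)
    case (Suc y)
    then show ?case using extendable_col_star[OF Suc] by (simp add: algebra_simps)
  qed (simp add: row)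
qed

section \<open>Base graphs and the codes grown from them\<close>

lemma extendable_3_3: "extendable 3 3 3"
proof -
  \<comment> \<open>A path on four vertices, with row 3 and column 3 isolated.\<close>
  have "extendable_code 3 3 {(1, 1), (1, 2), (2, 2)}"
    by (auto simp: extendable_code_def lone_edges_def)
  then show ?thesis unfolding extendable_def by force
qed

lemma two_stars:
  assumes "4 \<le> m" "m \<le> 5" "2 \<le> n" "n \<le> 3"
  shows "extendable n m 4"
proof -
  \<comment> \<open>Two paths centred at rows 1 and 2; row 3 and column 5, if present, are
    isolated.\<close>
  have "extendable_code n m {(1, 1), (1, 2), (2, 3), (2, 4)}"
    using assms by (auto simp: extendable_code_def lone_edges_def)
  then show ?thesis unfolding extendable_def by force
qed

text \<open>Each square \<open>(2, j)\<close> sees the whole code except \<open>(1, j)\<close>. This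
  single star is not an \<open>extendable_code\<close>: outside the grid, a square
  \<open>(1, b)\<close> would be undominated.\<close>

lemma rook_code_row:
  assumes "2 \<le> m"
  shows "rook_code 2 m ({1} \<times> {1..m})"
proof -
  have noncode: "fst u = 2" "snd u \<in> {1..m}" if "u \<in> {1..2::nat} \<times> {1..m} - {1} \<times> {1..m}" for u
    using that by auto
  have other: "\<exists>e\<in>{1} \<times> {1..m}. fst e \<noteq> fst u \<and> snd e \<noteq> snd u"
    if "u \<in> {1..2::nat} \<times> {1..m} - {1} \<times> {1..m}" for u
    using noncode[OF that] assms
    by (intro bexI[of _ "(1, if snd u = 1 then 2 else 1)"]) auto
  have sep: "{e \<in> {1} \<times> {1..m}. fst e \<noteq> fst u \<and> snd e \<noteq> snd u} \<noteq>
      {e \<in> {1} \<times> {1..m}. fst e \<noteq> fst v \<and> snd e \<noteq> snd v}"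
    if "u \<in> {1..2::nat} \<times> {1..m} - {1} \<times> {1..m}" "v \<in> {1..2::nat} \<times> {1..m} - {1} \<times> {1..m}" "u \<noteq> v" for u v
  proof -
    have "snd u \<noteq> snd v"
      using noncode that by (metis prod_eq_iff)
    then have "(1, snd v) \<in> {e \<in> {1} \<times> {1..m}. fst e \<noteq> fst u \<and> snd e \<noteq> snd u}"
      "(1, snd v) \<notin> {e \<in> {1} \<times> {1..m}. fst e \<noteq> fst v \<and> snd e \<noteq> snd v}"
      using noncode[OF that(1)] noncode[OF that(2)] by auto
    then show ?thesis by blast
  qed
  have sub: "{1::nat} \<times> {1..m} \<subseteq> {1..2} \<times> {1..m}" "{1::nat} \<times> {1..m} \<noteq> {}"
    using assms by auto
  show ?thesis
    unfolding rook_code_iff by (intro conjI ballI impI sub other sep)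
qed

lemma extendable_middle:
  assumes "3 \<le> n" "n \<le> m" "m < 2 * n" "(n, m) \<noteq> (4, 4)"
  shows "\<exists>k. extendable n m k \<and> 3 * k + 2 \<le> 2 * n + 2 * m"
proof -
  \<comment> \<open>Row stars keep \<open>2 * n - m\<close> fixed and column stars raise it by 3.
    The bases with 3 rows and 3, 4 or 5 columns start at 3, 2 or 1, so \<open>y\<close> counts the
    column stars; \<open>x\<close> row stars supply the remaining rows.\<close>
  define y where "y = (2 * n - m - 1) div 3"
  define x where "x = n - 3 - 2 * y"
  have y: "3 * y + m + 1 \<le> 2 * n" "2 * n < 3 * y + m + 4"
    using assms by (auto simp: y_def)
  \<comment> \<open>The count \<open>x\<close> must not be truncated. This is where
    \<open>(4, 4)\<close> drops out: there \<open>y = 1\<close>, which would need five rows.\<close>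
  have "3 + 2 * y \<le> n"
  proof (cases "n \<le> 4")
    case True
    then have "n = 3 \<or> n = 4" using assms by auto
    then show ?thesis using y assms by auto
  next
    case False
    then show ?thesis using y assms by linarith
  qed
  then have n: "n = 3 + x + 2 * y"
    by (simp add: x_def)
  then have "m = 3 + 2 * x + y \<or> m = 4 + 2 * x + y \<or> m = 5 + 2 * x + y"
    using y by linarith
  then consider "m = 3 + 2 * x + y" | "m = 4 + 2 * x + y" | "m = 5 + 2 * x + y"
    by blast
  then show ?thesis
  proof cases
    case 1
    then show ?thesis
      using extendable_stars[OF extendable_3_3, of x y] n by (auto intro!: exI[of _ "3 + 2 * x + 2 * y"])
  next
    case 2
    then show ?thesis
      using extendable_stars[OF two_stars[of 4 3], of x y] n
      by (auto intro!: exI[of _ "4 + 2 * x + 2 * y"])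
  next
    case 3
    then show ?thesis
      using extendable_stars[OF two_stars[of 5 3], of x y] n
      by (auto intro!: exI[of _ "4 + 2 * x + 2 * y"])
  qed
qed

text \<open>Row stars lead from the base with 3 rows and 5 columns to \<open>2 * n - 1\<close>
  columns, one of them isolated, with one edge in each other column. Leaves keep this pattern. For
  \<open>n = 2\<close> the growth starts at 5 columns, as \<open>(2, 4)\<close> is excluded.\<close>

lemma extendable_long:
  assumes "2 \<le> n" "2 * n \<le> m" "(n, m) \<noteq> (2, 4)"
  shows "extendable n m (m - 1)"
proof (cases "n = 2")
  case True
  then have "extendable 2 (5 + (m - 5)) (4 + (m - 5))"
    using two_stars[of 5 2] by (intro extendable_col_leaves) simp
  moreover have "5 + (m - 5) = m" "4 + (m - 5) = m - 1"
    using assms True by auto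
  ultimately show ?thesis using True by simp
next
  case False
  have "extendable (3 + (n - 3) + 2 * 0) (5 + 2 * (n - 3) + 0) (4 + 2 * (n - 3) + 2 * 0)"
    using two_stars[of 5 3] by (intro extendable_stars) simp
  moreover have "3 + (n - 3) + 2 * 0 = n" "5 + 2 * (n - 3) + 0 = 2 * n - 1"
    "4 + 2 * (n - 3) + 2 * 0 = 2 * n - 2"
    using assms False by auto
  ultimately have "extendable n (2 * n - 1) (2 * n - 2)" by simp
  then have "extendable n (2 * n - 1 + (m - (2 * n - 1))) (2 * n - 2 + (m - (2 * n - 1)))"
    by (rule extendable_col_leaves)
  moreover have "2 * n - 1 + (m - (2 * n - 1)) = m" "2 * n - 2 + (m - (2 * n - 1)) = m - 1"
    using assms by auto
  ultimately show ?thesis by simp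
qed

lemma gamma_LD_extendableI:
  assumes "extendable n m k" "\<And>D. rook_code n m D \<Longrightarrow> k \<le> card D"
  shows "gamma_LD (dprod_vert (K_vert n) (K_vert m)) (dprod_adj K_adj K_adj) = k"
  using assms extendable_code_imp_rook_code gamma_LD_direct_productI
  unfolding extendable_def by blast

section \<open>The four cases combined\<close>

theorem theorem15:
  fixes n m :: nat
  assumes "2 \<le> n" and "n \<le> m"
  shows "int (gamma_LD (dprod_vert (K_vert n) (K_vert m)) (dprod_adj K_adj K_adj)) =
    (if 2 * n \<le> m \<and> (n, m) \<noteq> (2, 4) then int m - 1
     else if 2 < n \<and> m < 2 * n \<and> (n, m) \<noteq> (4, 4)
       then ceiling ((2 * real n + 2 * real m - 1) / 3) - 1
     else if n = 2 \<and> m \<le> 4 then int m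
     else 5)"
proof -
  let ?g = "gamma_LD (dprod_vert (K_vert n) (K_vert m)) (dprod_adj K_adj K_adj)"
  have m2: "2 \<le> m" using assms by simp
  consider (long) "2 * n \<le> m" "(n, m) \<noteq> (2, 4)"
    | (middle) "3 \<le> n" "m < 2 * n" "(n, m) \<noteq> (4, 4)"
    | (two) "n = 2" "m \<le> 4"
    | (four) "n = 4" "m = 4"
    using assms by force
  then show ?thesis
  proof cases
    case long
    have "?g = m - 1"
      using extendable_long[OF assms(1) long] code_card_ge_columns[OF assms(1) m2]
      by (rule gamma_LD_extendableI)
    then show ?thesis using long m2 by auto
  next
    case middle
    obtain k where k: "extendable n m k" "3 * k + 2 \<le> 2 * n + 2 * m"
      using extendable_middle[OF middle(1) assms(2) middle(2,3)] by blast
    have lower: "2 * n + 2 * m \<le> 3 * card D + 4" if "rook_code n m D" for D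
      using code_card_ge_weight[OF assms(1) m2 that] .
    have "rook_code n m D \<Longrightarrow> k \<le> card D" for D
      \<comment> \<open>A code with at most \<open>k - 1\<close> edges would give
        \<open>2 * n + 2 * m \<le> 3 * k + 1\<close>, against the size of \<open>k\<close>.\<close>
      using lower[of D] k(2) by linarith
    with k(1) have g: "?g = k"
      by (rule gamma_LD_extendableI)
    have "2 * n + 2 * m \<le> 3 * k + 4"
      using k(1) lower extendable_code_imp_rook_code unfolding extendable_def by blast
    then have "2 * real n + 2 * real m \<le> 3 * real k + 4" "3 * real k + 2 \<le> 2 * real n + 2 * real m"
      using k(2) by linarith+
    \<comment> \<open>The quotient lies between \<open>k + 1 / 3\<close> and
      \<open>k + 1\<close>.\<close>
    then have "ceiling ((2 * real n + 2 * real m - 1) / 3) = int k + 1"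
      by (intro ceiling_unique) simp_all
    then show ?thesis using g middle by auto
  next
    case two
    have "?g = m"
    proof (rule gamma_LD_direct_productI)
      show "rook_code n m ({1} \<times> {1..m})" "card ({1::nat} \<times> {1..m}) = m"
        using rook_code_row[OF m2] two by simp_all
      show "m \<le> card D" if "rook_code n m D" for D
        using code_card_two_rows[OF assms(1) m2 that two] .
    qed
    then show ?thesis using two by auto
  next
    case four
    \<comment> \<open>The path on four vertices with one column leaf and one row leaf.\<close>
    have "extendable 4 4 5"
      using extendable_row_leaf[OF extendable_col_leaf[OF extendable_3_3]] by (simp add: numeral_eq_Suc)
    then have "extendable n m 5" using four by simp
    then have "?g = 5"
      using code_card_four_four[OF assms(1) m2 _ four] by (rule gamma_LD_extendableI)
    then show ?thesis using four by auto
  qed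
qed

end
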